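(* Let $(X,m,T)$ be an aperiodic, ergodic, probability preserving transformation of a standard probability space. For each $r\in\mathbb{R}_+$ there exists a measurable function $g=g_r:X\to\mathbb{R}_+$ such that $\mathfrak{e}(g,T)=r$ $m$-a.s.
   Context: $\mathbb{R}_+=[0,\infty)$. Aperiodic means $m(\{x\in X:T^nx=x\})=0$ for every $n\ge1$. Extravagance. For a sequence $(x_n)_{n\ge1}$ in $[0,\infty)$, not identically $0$, set $\mathbbm{e}((x_n)):=\limsup_{n\to\infty}\frac{x_{n+1}}{\sum_{k=1}^n x_k}\in[0,\infty]$; for the zero sequence set $\mathbbm{e}(\overline 0):=0$. For a probability preserving transformation $T$ of $(X,m)$ and a measurable $g:X\to[0,\infty)$, $\mathfrak{e}(g,T)(x):=\mathbbm{e}((g(T^nx):n\ge0))$. *)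

theory Defs
  imports "HOL-Probability.Probability"
begin

definition standard_probability_space :: "'a measure \<Rightarrow> bool" where
  "standard_probability_space M \<longleftrightarrow>
     prob_space M \<and>
     (\<exists>X. completely_metrizable_space X \<and> separable_space X \<and> topspace X = space M \<and>
          sets M = sigma_sets (space M) {U. openin X U})"

definition measure_preserving_map :: "'a measure \<Rightarrow> ('a \<Rightarrow> 'a) \<Rightarrow> bool" where
  "measure_preserving_map M T \<longleftrightarrow> T \<in> measurable M M \<and> distr M M T = M"

definition ergodic_map :: "'a measure \<Rightarrow> ('a \<Rightarrow> 'a) \<Rightarrow> bool" where
  "ergodic_map M T \<longleftrightarrow>
     (\<forall>A\<in>sets M. T -` A \<inter> space M = A \<longrightarrow> A \<in> null_sets M \<or> space M - A \<in> null_sets M)"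

definition aperiodic_map :: "'a measure \<Rightarrow> ('a \<Rightarrow> 'a) \<Rightarrow> bool" where
  "aperiodic_map M T \<longleftrightarrow> (\<forall>n\<ge>1. {x \<in> space M. (T ^^ n) x = x} \<in> null_sets M)"

(* Sequences are indexed from 0, so that x k here is the usual x_(k+1).
   If x is nonnegative and not the zero sequence, only finitely many of the denominators vanish,
   so the convention a / 0 = 0 does not influence the limsup. *)
definition extravagance :: "(nat \<Rightarrow> real) \<Rightarrow> ereal" where
  "extravagance x =
     (if \<forall>n. x n = 0 then 0
      else limsup (\<lambda>n. ereal (x (Suc n) / (\<Sum>k\<le>n. x k))))"

definition extravagance_fun :: "('a \<Rightarrow> real) \<Rightarrow> ('a \<Rightarrow> 'a) \<Rightarrow> 'a \<Rightarrow> ereal" where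
  "extravagance_fun g T x = extravagance (\<lambda>n. g ((T ^^ n) x))"

end

theory Submission
  imports Defs
begin

text \<open>For \<open>r > 0\<close> put \<open>\<theta> = 1 + r\<close> and let \<open>\<phi>\<^sub>B\<close> be the hitting time of \<open>B\<close>. The function
  \<open>\<theta> ^ (- \<phi>\<^sub>B)\<close> grows at most by the factor \<open>\<theta>\<close> per step, and so does every sum
  \<open>g = (\<Sum>l. c l * \<theta> ^ (- \<phi>\<^sub>B\<^sub>l))\<close>; summing a geometric series, this alone forces the extravagance
  of \<open>g\<close> to be at most \<open>r\<close>. When the orbit first hits \<open>B\<^sub>k\<close>, the \<open>k\<close>-th summand has just climbed
  geometrically to \<open>c k\<close>, with past sum about \<open>c k / r\<close>, so equality holds if at that time the other
  summands are negligible. For \<open>l < k\<close> this holds if \<open>c k\<close> is large compared with the hitting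
  time, and for \<open>l > k\<close> if \<open>\<phi>\<^sub>B\<^sub>l\<close> is still large compared with \<open>ln (c l)\<close>. The two requirements are
  compatible when \<open>B\<^sub>l\<close> is the base of a Rokhlin tower of height \<open>n\<close>: with probability close to 1
  the hitting time is below \<open>n\<close>, but above a small multiple of \<open>n\<close>.\<close>

section \<open>Sets of small positive measure\<close>

text \<open>Otherwise every set of measure below \<delta> is null. Since points are null, small
  enough balls around any point are null, and separability covers the space by countably many of
  them.\<close>

lemma standard_small_set:
  fixes M :: "'a measure"
  assumes std: "standard_probability_space M"
    and no_atom: "\<And>x. x \<in> space M \<Longrightarrow> measure M {x} = 0"
    and \<delta>: "\<delta> > 0"
  shows "\<exists>A\<in>sets M. 0 < measure M A \<and> measure M A < \<delta>"
proof (rule ccontr)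
  assume "\<not> ?thesis"
  then have null: "measure M A = 0" if "A \<in> sets M" "measure M A < \<delta>" for A
    using that by (metis measure_le_0_iff not_le)
  interpret prob_space M
    using std by (simp add: standard_probability_space_def)
  obtain X where X: "completely_metrizable_space X" "separable_space X" "topspace X = space M"
    "sets M = sigma_sets (space M) {U. openin X U}"
    using std by (auto simp: standard_probability_space_def)
  from X(1) have "metrizable_space X"
    by (rule completely_metrizable_imp_metrizable_space)
  then obtain S d where Sd: "Metric_space S d" "X = Metric_space.mtopology S d"
    by (auto simp: metrizable_space_def)
  interpret Metric_space S d by (rule Sd)
  have S: "S = space M"
    using X(3) Sd(2) by simp
  have ball_meas: "mball x q \<in> sets M" for x q
    unfolding X(4) using Sd(2) by (intro sigma_sets.Basic) simp
  obtain C where C: "countable C" "C \<subseteq> S" "mtopology closure_of C = S"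
    using X(2) unfolding separable_space_def Sd(2) topspace_mtopology by blast
  define I where "I = {(c, k::nat). c \<in> C \<and> measure M (mball c (1 / Suc k)) < \<delta>}"
  have "I \<subseteq> C \<times> UNIV"
    by (auto simp: I_def)
  then have "countable I"
    using C(1) by (meson countable_SIGMA countable_subset uncountable_def countableI_type)
  then have "(\<Union>(c, k)\<in>I. mball c (1 / Suc k)) \<in> null_sets M"
  proof (rule null_sets_UN')
    fix i assume "i \<in> I"
    then show "(case i of (c, k) \<Rightarrow> mball c (1 / Suc k)) \<in> null_sets M"
      using null[OF ball_meas] ball_meas
      by (auto simp: I_def null_sets_def emeasure_eq_measure)
  qed
  moreover have "space M \<subseteq> (\<Union>(c, k)\<in>I. mball c (1 / Suc k))"
  proof
    fix x assume x: "x \<in> space M"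
    have "(\<lambda>k. measure M (mball x (1 / Suc k))) \<longlonglongrightarrow> measure M (\<Inter>k. mball x (1 / Suc k))"
    proof (rule finite_Lim_measure_decseq)
      show "decseq (\<lambda>k. mball x (1 / Suc k))"
        by (intro decseq_SucI mball_subset_concentric) (simp add: field_simps)
    qed (use ball_meas in auto)
    moreover have "(\<Inter>k. mball x (1 / Suc k)) = {x}"
    proof (intro equalityI subsetI)
      fix y assume "y \<in> (\<Inter>k. mball x (1 / Suc k))"
      then have y: "y \<in> S" "d x y < 1 / Suc k" for k
        by auto
      have "\<not> 0 < d x y"
        by (metis y(2) nat_approx_posE less_asym)
      then show "y \<in> {x}"
        using y(1) x S by (simp add: mdist_pos_eq)
    next
      fix y assume "y \<in> {x}"
      moreover have "x \<in> S"
        using x S by simp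
      ultimately show "y \<in> (\<Inter>k. mball x (1 / Suc k))"
        by (simp add: add_pos_nonneg)
    qed
    ultimately have "(\<lambda>k. measure M (mball x (1 / Suc k))) \<longlonglongrightarrow> 0"
      using no_atom[OF x] by simp
    from order_tendstoD(2)[OF this \<delta>]
    obtain k where k: "measure M (mball x (1 / Suc k)) < \<delta>"
      by (auto simp: eventually_sequentially)
    \<comment> \<open>The radius is halved: a centre \<open>c\<close> of the dense set within half
      the radius of \<open>x\<close> gives a ball that contains \<open>x\<close> and stays inside
      the small ball around \<open>x\<close>.\<close>
    define k' where "k' = 2 * k + 1"
    have k': "1 / Suc k' + 1 / Suc k' = 1 / Suc k"
      unfolding k'_def by (simp add: field_simps)
    have "x \<in> mtopology closure_of C"
      using C(3) S x by simp
    then obtain c where c: "c \<in> C" "c \<in> mball x (1 / Suc k')"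
      by (auto simp: metric_closure_of) (metis of_nat_0_less_iff zero_less_Suc zero_less_divide_1_iff of_nat_Suc)
    have "mball c (1 / Suc k') \<subseteq> mball x (1 / Suc k)"
      using c(2) k' by (intro mball_subset) (auto simp: commute)
    then have "measure M (mball c (1 / Suc k')) < \<delta>"
      using k by (meson ball_meas finite_measure_mono le_less_trans)
    then have "(c, k') \<in> I"
      using c(1) by (simp add: I_def)
    moreover have "x \<in> mball c (1 / Suc k')"
      using c(2) by (auto simp: commute)
    ultimately show "x \<in> (\<Union>(c, k)\<in>I. mball c (1 / Suc k))"
      by blast
  qed
  ultimately have "space M \<in> null_sets M"
    by (meson null_sets_subset sets.top)
  then show False
    by (simp add: null_sets_def emeasure_space_1)
qed

lemma standard_singleton_sets:
  assumes std: "standard_probability_space M" and x: "x \<in> space M"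
  shows "{x} \<in> sets M"
proof -
  obtain X where X: "completely_metrizable_space X" "topspace X = space M"
    "sets M = sigma_sets (space M) {U. openin X U}"
    using std by (auto simp: standard_probability_space_def)
  have "t1_space X"
    using X(1) by (simp add: Hausdorff_imp_t1_space completely_metrizable_imp_metrizable_space
        metrizable_imp_Hausdorff_space)
  then have "openin X (space M - {x})"
    using x X(2) by (metis closedin_t1_singleton openin_diff openin_topspace)
  then have "space M - {x} \<in> sets M"
    unfolding X(3) by (intro sigma_sets.Basic) simp
  then have "space M - (space M - {x}) \<in> sets M"
    by blast
  then show ?thesis
    using x by (simp add: double_diff)
qed

section \<open>Hitting times\<close>

locale ergodic_system = prob_space M for M :: "'a measure" +
  fixes T :: "'a \<Rightarrow> 'a"
  assumes mp: "measure_preserving_map M T"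
    and erg: "ergodic_map M T"
begin

lemma iter_measurable [measurable]: "T ^^ n \<in> measurable M M"
proof (induction n)
  case (Suc n)
  then show ?case
    using mp by (auto simp: measure_preserving_map_def intro: measurable_comp)
qed (simp add: id_def)

lemma iter_space: "x \<in> space M \<Longrightarrow> (T ^^ n) x \<in> space M"
  using measurable_space[OF iter_measurable] .

lemma iter_preimage_sets [measurable]:
  assumes "A \<in> sets M"
  shows "{x \<in> space M. (T ^^ n) x \<in> A} \<in> sets M"
  using measurable_sets[OF iter_measurable assms, of n] by (simp add: vimage_def Int_def conj_commute)

lemma measure_iter_preimage:
  assumes A: "A \<in> sets M"
  shows "measure M {x \<in> space M. (T ^^ n) x \<in> A} = measure M A"
proof (induction n)
  case 0
  then show ?case
    using sets.sets_into_space[OF A] by (auto intro!: arg_cong[where f = "measure M"])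
next
  case (Suc n)
  let ?B = "{x \<in> space M. (T ^^ n) x \<in> A}"
  have T: "T \<in> measurable M M" "distr M M T = M"
    using mp by (auto simp: measure_preserving_map_def)
  have "{x \<in> space M. (T ^^ Suc n) x \<in> A} = T -` ?B \<inter> space M"
    using measurable_space[OF T(1)] by (auto simp: funpow_swap1)
  then have "measure M {x \<in> space M. (T ^^ Suc n) x \<in> A} = measure (distr M M T) ?B"
    using T(1) iter_preimage_sets[OF A] by (simp add: measure_distr)
  then show ?case
    using T(2) Suc by simp
qed

section \<open>Consequences of aperiodicity and ergodicity\<close>

text \<open>Mass cannot decrease along an orbit, because \<open>x\<close> lies in the preimage of
  its own image. An orbit starting at an atom therefore has only finitely many points and ends in a
  cycle, whose points lie in a null set by aperiodicity.\<close>

lemma point_measure_zero: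
  assumes std: "standard_probability_space M" and ap: "aperiodic_map M T" and x: "x \<in> space M"
  shows "measure M {x} = 0"
proof (rule ccontr)
  assume nz: "measure M {x} \<noteq> 0"
  have orbit: "measure M {x} \<le> measure M {(T ^^ n) x}" for n
  proof -
    have "{(T ^^ n) x} \<in> sets M"
      using standard_singleton_sets[OF std iter_space[OF x]] .
    from measure_iter_preimage[OF this, of n] iter_preimage_sets[OF this, of n]
    show ?thesis
      using finite_measure_mono[of "{x}" "{y \<in> space M. (T ^^ n) y \<in> {(T ^^ n) x}}"] x
      by auto
  qed
  \<comment> \<open>\<open>T\<close> may fail to be injective, so the orbit is only eventually
    periodic; \<open>a\<close> is the length of its initial segment.\<close>
  have "\<exists>a p. p \<ge> 1 \<and> (T ^^ (a + p)) x = (T ^^ a) x"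
  proof (rule ccontr)
    assume no: "\<not> ?thesis"
    then have inj: "inj (\<lambda>n. (T ^^ n) x)"
      by (intro linorder_injI) (metis less_imp_add_positive less_one not_le neq0_conv)
    obtain K :: nat where K: "real K * measure M {x} > 1"
      using reals_Archimedean3[of "measure M {x}"] nz by (auto simp: zero_less_measure_iff)
    have "real K * measure M {x} \<le> (\<Sum>n<K. measure M {(T ^^ n) x})"
      using sum_mono[of "{..<K}" "\<lambda>_. measure M {x}", OF orbit] by simp
    also have "\<dots> = measure M (\<Union>n<K. {(T ^^ n) x})"
      using inj standard_singleton_sets[OF std iter_space[OF x]]
      by (intro finite_measure_finite_Union[symmetric])
        (auto simp: disjoint_family_on_def dest: injD)
    also have "\<dots> \<le> 1"
      by simp
    finally show False
      using K by simp
  qed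
  then obtain a p where p: "p \<ge> 1" "(T ^^ (a + p)) x = (T ^^ a) x"
    by blast
  let ?P = "{y \<in> space M. (T ^^ p) y = y}"
  have P: "?P \<in> null_sets M"
    using ap p(1) by (simp add: aperiodic_map_def)
  have "(T ^^ a) x \<in> ?P"
    using p(2) iter_space[OF x] by (simp add: add.commute[of a] funpow_add)
  then have "measure M {(T ^^ a) x} \<le> measure M ?P"
    using P by (intro finite_measure_mono) auto
  then have "measure M {(T ^^ a) x} \<le> 0"
    using P by (simp add: measure_eq_0_null_sets)
  then show False
    using orbit[of a] nz by (simp add: measure_le_0_iff)
qed

text \<open>The set \<open>H\<close> of points that visit \<open>A\<close> infinitely often is the
  decreasing limit of sets of measure at least that of \<open>A\<close>, so ergodicity gives it full
  measure.\<close>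

lemma never_hits_measure_zero:
  assumes A: "A \<in> sets M" and pos: "measure M A > 0"
  shows "measure M {x \<in> space M. \<forall>j. (T ^^ j) x \<notin> A} = 0"
proof -
  \<comment> \<open>Infinitely many visits are needed for \<open>H\<close> to equal its preimage, as
    \<open>ergodic_map\<close> requires; the set \<open>E 0\<close> of points with at least one
    visit merely contains its preimage.\<close>
  define E where "E k = {x \<in> space M. \<exists>j\<ge>k. (T ^^ j) x \<in> A}" for k :: nat
  have E[measurable]: "E k \<in> sets M" for k
    unfolding E_def using A by measurable
  have anti: "E (Suc k) \<subseteq> E k" for k
    by (auto simp: E_def intro: Suc_leD)
  define H where "H = (\<Inter>k. E k)"
  have H: "H \<in> sets M"
    unfolding H_def by measurable
  have "(\<lambda>k. measure M (E k)) \<longlonglongrightarrow> measure M H"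
    unfolding H_def
    by (intro finite_Lim_measure_decseq decseq_SucI) (use E anti in auto)
  moreover have "measure M A \<le> measure M (E k)" for k
    using finite_measure_mono[OF _ E, of "{x \<in> space M. (T ^^ k) x \<in> A}" k]
      measure_iter_preimage[OF A, of k]
    by (auto simp: E_def)
  ultimately have "measure M A \<le> measure M H"
    by (meson LIMSEQ_le_const)
  then have Hpos: "H \<notin> null_sets M"
    using pos by (auto simp: measure_eq_0_null_sets)
  have Tsp: "T x \<in> space M" if "x \<in> space M" for x
    using iter_space[OF that, of 1] by simp
  have shift: "T x \<in> E k \<longleftrightarrow> x \<in> E (Suc k)" if "x \<in> space M" for x k
  proof -
    have "(\<exists>j\<ge>Suc k. (T ^^ j) x \<in> A) \<longleftrightarrow> (\<exists>j\<ge>k. (T ^^ Suc j) x \<in> A)"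
      by (metis Suc_le_D Suc_le_mono)
    also have "\<dots> \<longleftrightarrow> (\<exists>j\<ge>k. (T ^^ j) (T x) \<in> A)"
      by (simp add: funpow_swap1)
    finally show ?thesis
      using that Tsp by (auto simp: E_def)
  qed
  have "T -` H \<inter> space M = H"
  proof (intro equalityI subsetI)
    fix x assume "x \<in> T -` H \<inter> space M"
    then have "x \<in> E (Suc k)" for k
      using shift by (auto simp: H_def)
    then show "x \<in> H"
      using anti by (auto simp: H_def)
  next
    fix x assume x: "x \<in> H"
    then have "x \<in> space M"
      by (auto simp: H_def E_def)
    then show "x \<in> T -` H \<inter> space M"
      using shift x by (auto simp: H_def)
  qed
  then have "space M - H \<in> null_sets M"
    using erg H Hpos by (auto simp: ergodic_map_def)
  then have "measure M (space M - H) = 0"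
    by (rule measure_eq_0_null_sets)
  moreover have "measure M {x \<in> space M. \<forall>j. (T ^^ j) x \<notin> A} \<le> measure M (space M - H)"
  proof (rule finite_measure_mono)
    have "H \<subseteq> E 0"
      by (auto simp: H_def)
    then show "{x \<in> space M. \<forall>j. (T ^^ j) x \<notin> A} \<subseteq> space M - H"
      unfolding E_def by blast
  qed (use H in auto)
  ultimately have "measure M {x \<in> space M. \<forall>j. (T ^^ j) x \<notin> A} \<le> 0"
    by simp
  then show ?thesis
    by (simp add: measure_le_0_iff)
qed

text \<open>The hitting time of \<open>A\<close>; it is only meaningful at points whose orbit meets \<open>A\<close>.\<close>

definition hit :: "'a set \<Rightarrow> 'a \<Rightarrow> nat" where
  "hit A x = (LEAST j. (T ^^ j) x \<in> A)"

lemma hit_measurable [measurable]: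
  assumes "A \<in> sets M"
  shows "hit A \<in> measurable M (count_space UNIV)"
  unfolding hit_def[abs_def] using assms by measurable

lemma hit_in: "(T ^^ j) x \<in> A \<Longrightarrow> (T ^^ hit A x) x \<in> A"
  unfolding hit_def by (rule LeastI)

lemma hit_le: "(T ^^ j) x \<in> A \<Longrightarrow> hit A x \<le> j"
  unfolding hit_def by (rule Least_le)

lemma hit_iter:
  assumes "(T ^^ j) x \<in> A" "i \<le> hit A x"
  shows "hit A ((T ^^ i) x) = hit A x - i"
proof -
  have "(T ^^ (hit A x - i)) ((T ^^ i) x) \<in> A"
    using hit_in[OF assms(1)] assms(2) by (metis add_diff_inverse_nat add.commute comp_apply funpow_add not_le)
  then have le: "hit A ((T ^^ i) x) \<le> hit A x - i"
    and in_A: "(T ^^ hit A ((T ^^ i) x)) ((T ^^ i) x) \<in> A"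
    by (auto intro: hit_le hit_in)
  have "hit A x \<le> hit A ((T ^^ i) x) + i"
    using in_A by (intro hit_le) (simp add: funpow_add)
  then show ?thesis
    using le by simp
qed

text \<open>Cutting the hitting time of a very small set into blocks of length \<open>n\<close> gives a Rokhlin tower
  of height \<open>n\<close>; since it only looks at the future, invertibility is not needed.\<close>

lemma rokhlin_base:
  assumes A: "A \<in> sets M" and n: "n \<ge> 1"
  obtains B where "B \<in> sets M" "real n * measure M B \<le> 1"
    "\<And>x j. x \<in> space M \<Longrightarrow> (T ^^ j) x \<in> A \<Longrightarrow> n \<le> hit A x \<Longrightarrow> \<exists>j<n. (T ^^ j) x \<in> B"
proof
  \<comment> \<open>The condition \<open>0 < hit A x\<close> excludes \<open>A\<close> itself, so
    that every point of \<open>B\<close> is at least \<open>n\<close> steps away from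
    \<open>A\<close>.\<close>
  define B where "B = {x \<in> space M. (\<exists>j. (T ^^ j) x \<in> A) \<and> 0 < hit A x \<and> n dvd hit A x}"
  show B: "B \<in> sets M"
    unfolding B_def using A by measurable
  define F where "F i = {x \<in> space M. (T ^^ i) x \<in> B}" for i
  have F: "F i \<in> sets M" for i
    unfolding F_def using B by measurable
  \<comment> \<open>Between two visits to \<open>B\<close> less than \<open>n\<close> steps apart
    the hitting time of \<open>A\<close> drops by exactly \<open>j - i\<close>. Both values are
    multiples of \<open>n\<close>, which is impossible.\<close>
  have not_both: False if "i < j" "j < n" "x \<in> F i" "x \<in> F j" for i j x
  proof -
    define y where "y = (T ^^ i) x"
    have y: "y \<in> B" "(T ^^ (j - i)) y \<in> B"
      using that unfolding y_def F_def
      by (auto simp flip: comp_apply[of "T ^^ (j - i)"] funpow_add)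
    then obtain l where l: "(T ^^ l) y \<in> A" and h: "0 < hit A y" "n dvd hit A y"
      by (auto simp: B_def)
    have "n \<le> hit A y"
      using h by (rule_tac dvd_imp_le)
    then have "hit A ((T ^^ (j - i)) y) = hit A y - (j - i)"
      using that by (intro hit_iter[OF l]) auto
    then have "n dvd hit A y - (j - i)"
      using y(2) by (simp add: B_def)
    then have "n dvd j - i"
      using h(2) \<open>n \<le> hit A y\<close> that(1,2) by (metis diff_diff_cancel dvd_diff_nat less_imp_diff_less
          less_imp_le_nat order_trans)
    then show False
      using that(1,2) by (auto dest: dvd_imp_le)
  qed
  have "real n * measure M B = (\<Sum>i<n. measure M (F i))"
    unfolding F_def measure_iter_preimage[OF B] by simp
  also have "\<dots> = measure M (\<Union>i<n. F i)"
    using F not_both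
    by (intro finite_measure_finite_Union[symmetric])
      (auto simp: disjoint_family_on_def, metis linorder_neqE_nat)
  also have "\<dots> \<le> 1"
    by simp
  finally show "real n * measure M B \<le> 1" .
  fix x j assume x: "x \<in> space M" "(T ^^ j) x \<in> A" "n \<le> hit A x"
  \<comment> \<open>After the remainder is used up, the remaining hitting time is a multiple of
    \<open>n\<close>, and it is positive because \<open>n \<le> hit A x\<close>.\<close>
  define i where "i = hit A x mod n"
  have i: "i < n" "i \<le> hit A x"
    using n x(3) by (auto simp: i_def)
  have "hit A ((T ^^ i) x) = hit A x - i"
    using x(2) i(2) by (rule hit_iter)
  moreover have "n dvd hit A x - i"
    unfolding i_def by (rule dvd_minus_mod)
  moreover have "(T ^^ (hit A x - i)) ((T ^^ i) x) \<in> A"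
    using hit_in[OF x(2)] i(2) by (metis add_diff_inverse_nat add.commute comp_apply funpow_add not_le)
  ultimately have "(T ^^ i) x \<in> B"
    using i x(3) iter_space[OF x(1)] by (auto simp: B_def)
  then show "\<exists>j<n. (T ^^ j) x \<in> B"
    using i(1) by blast
qed

section \<open>Exponential decay in the hitting time\<close>

text \<open>An orbit that misses \<open>B\<close> gets the value 0, as for an infinite hitting time.
  This makes the growth bound valid at every point and not only almost everywhere.\<close>

definition decay :: "real \<Rightarrow> 'a set \<Rightarrow> 'a \<Rightarrow> real" where
  "decay \<theta> B x = (if \<exists>j. (T ^^ j) x \<in> B then (1 / \<theta>) ^ hit B x else 0)"

lemma decay_measurable [measurable]:
  assumes "B \<in> sets M"
  shows "decay \<theta> B \<in> borel_measurable M"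
  unfolding decay_def[abs_def] using assms by measurable

lemma decay_nonneg: "\<theta> > 0 \<Longrightarrow> 0 \<le> decay \<theta> B x"
  by (simp add: decay_def)

lemma decay_le_1: "\<theta> \<ge> 1 \<Longrightarrow> decay \<theta> B x \<le> 1"
  by (simp add: decay_def power_le_one)

text \<open>The hitting time of \<open>x\<close> exceeds that of \<open>T x\<close> by at most one;
  it may be much smaller when \<open>x\<close> is in \<open>B\<close>, and then the value only
  drops.\<close>

lemma decay_step:
  assumes "\<theta> \<ge> 1"
  shows "decay \<theta> B (T x) \<le> \<theta> * decay \<theta> B x"
proof (cases "\<exists>j. (T ^^ j) (T x) \<in> B")
  case True
  then obtain j where j: "(T ^^ j) (T x) \<in> B"
    by blast
  let ?h = "hit B (T x)"
  have "(T ^^ Suc ?h) x \<in> B"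
    using hit_in[OF j] by (simp add: funpow_swap1)
  then have le: "hit B x \<le> Suc ?h" and ex: "\<exists>j. (T ^^ j) x \<in> B"
    by (blast intro: hit_le)+
  have "(1 / \<theta>) ^ ?h = \<theta> * (1 / \<theta>) ^ Suc ?h"
    using assms by simp
  also have "\<dots> \<le> \<theta> * (1 / \<theta>) ^ hit B x"
    using assms le by (intro mult_left_mono power_decreasing) auto
  finally show ?thesis
    using True ex by (simp add: decay_def)
next
  case False
  then show ?thesis
    using assms decay_nonneg[of \<theta> B x] by (simp add: decay_def)
qed

lemma decay_small:
  assumes "\<theta> \<ge> 1" "\<And>j. j \<le> J \<Longrightarrow> (T ^^ j) x \<notin> B"
  shows "decay \<theta> B x \<le> (1 / \<theta>) ^ J"
proof (cases "\<exists>j. (T ^^ j) x \<in> B")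
  case True
  then have "J \<le> hit B x"
    using assms(2) hit_in by (metis nat_le_linear)
  then show ?thesis
    using True assms(1) by (auto simp: decay_def intro!: power_decreasing)
qed (use assms(1) in \<open>simp add: decay_def\<close>)

text \<open>On the way to \<open>B\<close> the values climb through consecutive powers of
  \<open>1 / \<theta>\<close> up to \<open>1 / \<theta>\<close> itself, so their sum is part of a
  geometric series.\<close>

lemma decay_sum:
  assumes "\<theta> > 1" "(T ^^ j) x \<in> B"
  shows "(\<Sum>i<hit B x. decay \<theta> B ((T ^^ i) x)) \<le> 1 / (\<theta> - 1)"
proof -
  let ?N = "hit B x"
  have "decay \<theta> B ((T ^^ i) x) = (1 / \<theta>) ^ Suc (?N - Suc i)" if "i < ?N" for i
  proof -
    have "(T ^^ (?N - i)) ((T ^^ i) x) \<in> B"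
      using hit_in[OF assms(2)] that
      by (simp flip: comp_apply[of "T ^^ (?N - i)"] funpow_add)
    then show ?thesis
      using that hit_iter[OF assms(2), of i] by (auto simp: decay_def Suc_diff_Suc)
  qed
  then have "(\<Sum>i<?N. decay \<theta> B ((T ^^ i) x)) = (\<Sum>i<?N. (1 / \<theta>) ^ Suc (?N - Suc i))"
    by simp
  also have "\<dots> = (\<Sum>i<?N. (1 / \<theta>) ^ Suc i)"
    by (rule sum.nat_diff_reindex)
  also have "\<dots> = (1 - (1 / \<theta>) ^ ?N) / (\<theta> - 1)"
  proof -
    \<comment> \<open>This is the induction step of the closed form below, with \<open>p\<close> in
      place of \<open>(1 / \<theta>) ^ m\<close>.\<close>
    have "(1 - p) / (\<theta> - 1) + 1 / \<theta> * p = (1 - 1 / \<theta> * p) / (\<theta> - 1)" for p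
      using assms(1) by (simp add: field_simps)
    then have "(\<Sum>i<m. (1 / \<theta>) ^ Suc i) = (1 - (1 / \<theta>) ^ m) / (\<theta> - 1)" for m
      by (induction m) (simp_all only: sum.lessThan_Suc power_Suc, simp)
    then show ?thesis .
  qed
  also have "\<dots> \<le> 1 / (\<theta> - 1)"
    using assms(1) by (intro divide_right_mono) auto
  finally show ?thesis .
qed

end

section \<open>One stage of the construction\<close>

text \<open>Here \<open>n\<close> will be the tower height and \<open>J\<close> a time before which
  the base is rarely hit. With \<open>n\<close> proportional to \<open>J\<close>, the last quantity
  is linear in \<open>J\<close> times \<open>(1 / \<theta>) ^ J\<close> and tends to 0.\<close>

lemma stage_parameters:
  fixes \<theta> D \<epsilon> :: real
  assumes "\<theta> > 1" "\<epsilon> > 0"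
  shows "\<exists>J n :: nat. D \<le> J \<and> 1 \<le> n \<and> 2 * (real J + 1) \<le> \<epsilon> * n \<and> D * D * n * (1 / \<theta>) ^ J \<le> \<epsilon>"
proof -
  let ?q = "1 / \<theta>"
  have q: "norm ?q < 1" "0 < ?q"
    using assms(1) by auto
  \<comment> \<open>This is \<open>D * D * n * ?q ^ J\<close> with \<open>n\<close> replaced by its
    upper bound \<open>2 * (real J + 1) / \<epsilon> + 1\<close>.\<close>
  have "(\<lambda>J. D * D * (2 / \<epsilon>) * (real J * ?q ^ J) + D * D * (2 / \<epsilon> + 1) * ?q ^ J)
          \<longlonglongrightarrow> D * D * (2 / \<epsilon>) * 0 + D * D * (2 / \<epsilon> + 1) * 0"
    by (intro tendsto_add tendsto_mult tendsto_const powser_times_n_limit_0[OF q(1)]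
        LIMSEQ_power_zero[OF q(1)])
  then have "\<forall>\<^sub>F J in sequentially.
      D * D * (2 / \<epsilon>) * (real J * ?q ^ J) + D * D * (2 / \<epsilon> + 1) * ?q ^ J < \<epsilon>"
    using assms(2) by (intro order_tendstoD) auto
  moreover have "\<forall>\<^sub>F J in sequentially. D \<le> real J"
    using filterlim_real_sequentially by (simp add: filterlim_at_top)
  ultimately obtain J where J: "D \<le> real J"
    "D * D * (2 / \<epsilon>) * (real J * ?q ^ J) + D * D * (2 / \<epsilon> + 1) * ?q ^ J < \<epsilon>"
    using eventually_happens'[OF sequentially_bot eventually_conj] by blast
  define n where "n = nat \<lceil>2 * (real J + 1) / \<epsilon>\<rceil>"
  have pos: "2 * (real J + 1) / \<epsilon> > 0"
    using assms(2) by simp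
  have n: "2 * (real J + 1) / \<epsilon> \<le> real n" "real n \<le> 2 * (real J + 1) / \<epsilon> + 1"
    unfolding n_def using pos by linarith+
  have "D * D * n * ?q ^ J \<le> D * D * (2 * (real J + 1) / \<epsilon> + 1) * ?q ^ J"
    using n(2) q(2) by (intro mult_right_mono mult_left_mono) auto
  also have "\<dots> = D * D * (2 / \<epsilon>) * (real J * ?q ^ J) + D * D * (2 / \<epsilon> + 1) * ?q ^ J"
    by (simp add: algebra_simps add_divide_distrib)
  also have "\<dots> \<le> \<epsilon>"
    using J(2) by simp
  finally have "D * D * n * ?q ^ J \<le> \<epsilon>" .
  moreover have "2 * (real J + 1) \<le> \<epsilon> * n"
    using n(1) assms(2) by (simp add: field_simps)
  moreover have "1 \<le> n"
    using pos n(1) by linarith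
  ultimately show ?thesis
    using J(1) by blast
qed

text \<open>\<open>D\<close> carries all demands of the earlier stages: how small \<open>v\<close> must start and how much its peak
  must exceed the time \<open>n\<close>.\<close>

definition stage :: "'a measure \<Rightarrow> ('a \<Rightarrow> 'a) \<Rightarrow> real \<Rightarrow> real \<Rightarrow> real \<Rightarrow> ('a \<Rightarrow> real) \<Rightarrow> nat \<Rightarrow> 'a set \<Rightarrow> bool"
  where "stage M T \<theta> D \<epsilon> v n G \<longleftrightarrow>
    v \<in> borel_measurable M \<and> (\<forall>x. 0 \<le> v x \<and> v x \<le> D * n \<and> v (T x) \<le> \<theta> * v x) \<and>
    G \<in> sets M \<and> measure M (space M - G) \<le> \<epsilon> \<and>
    (\<forall>x\<in>G. D * v x \<le> \<epsilon> \<and>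
      (\<exists>N. D \<le> real N \<and> N \<le> n \<and> v ((T ^^ N) x) = D * n \<and>
        (\<Sum>i<N. v ((T ^^ i) x)) \<le> D * n / (\<theta> - 1)))"

text \<open>The function is \<open>decay\<close> towards the base \<open>B\<close> of a tower of
  height \<open>n\<close>, scaled to the peak \<open>D * n\<close>, and \<open>N\<close> is the
  hitting time of \<open>B\<close>.\<close>

lemma (in ergodic_system) stage_exists:
  assumes small: "\<And>\<delta>. \<delta> > 0 \<Longrightarrow> \<exists>A\<in>sets M. 0 < measure M A \<and> measure M A < \<delta>"
    and l: "\<theta> > 1" and D: "D \<ge> 1" and e: "\<epsilon> > 0"
  shows "\<exists>v n G. stage M T \<theta> D \<epsilon> v n G"
proof -
  obtain J n :: nat where n: "D \<le> J" "1 \<le> n" "2 * (real J + 1) \<le> \<epsilon> * n"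
      "D * D * n * (1 / \<theta>) ^ J \<le> \<epsilon>"
    using stage_parameters[OF l e, of D] by blast
  obtain A where A: "A \<in> sets M" "0 < measure M A" "measure M A < \<epsilon> / (2 * n)"
    using small[of "\<epsilon> / (2 * n)"] e n(2) by auto
  obtain B where B: "B \<in> sets M" "real n * measure M B \<le> 1"
    "\<And>x j. x \<in> space M \<Longrightarrow> (T ^^ j) x \<in> A \<Longrightarrow> n \<le> hit A x \<Longrightarrow> \<exists>j<n. (T ^^ j) x \<in> B"
    using rokhlin_base[OF A(1) n(2)] by blast
  define v where "v x = D * n * decay \<theta> B x" for x
  \<comment> \<open>Three kinds of bad points: \<open>Z\<close> never reaches \<open>A\<close>,
    \<open>U\<close> meets \<open>B\<close> too early for \<open>v\<close> to start small, and
    \<open>W\<close> meets \<open>A\<close> too early for the tower to guarantee a visit to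
    \<open>B\<close> before time \<open>n\<close>.\<close>
  define Z where "Z = {x \<in> space M. \<forall>j. (T ^^ j) x \<notin> A}"
  define U where "U = (\<Union>j<Suc J. {x \<in> space M. (T ^^ j) x \<in> B})"
  define W where "W = (\<Union>j<n. {x \<in> space M. (T ^^ j) x \<in> A})"
  define G where "G = space M - (Z \<union> U \<union> W)"
  have meas: "Z \<in> sets M" "U \<in> sets M" "W \<in> sets M"
  proof -
    have "Z = space M - (\<Union>j. {x \<in> space M. (T ^^ j) x \<in> A})"
      unfolding Z_def by blast
    then show "Z \<in> sets M"
      using iter_preimage_sets[OF A(1)] by (auto intro!: sets.countable_UN)
    show "U \<in> sets M" "W \<in> sets M"
      unfolding U_def W_def using iter_preimage_sets[OF A(1)] iter_preimage_sets[OF B(1)]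
      by (auto intro!: sets.finite_UN)
  qed
  have "measure M U \<le> (\<Sum>j<Suc J. measure M {x \<in> space M. (T ^^ j) x \<in> B})"
    unfolding U_def using iter_preimage_sets[OF B(1)]
    by (intro finite_measure_subadditive_finite) auto
  also have "\<dots> = (real J + 1) * measure M B"
    unfolding measure_iter_preimage[OF B(1)] by simp
  also have "\<dots> \<le> \<epsilon> * n / 2 * measure M B"
    using n(3) by (intro mult_right_mono) auto
  also have "\<dots> \<le> \<epsilon> / 2"
    using mult_left_mono[OF B(2), of "\<epsilon> / 2"] e by simp
  finally have U: "measure M U \<le> \<epsilon> / 2" .
  have "measure M W \<le> (\<Sum>j<n. measure M {x \<in> space M. (T ^^ j) x \<in> A})"
    unfolding W_def using iter_preimage_sets[OF A(1)]
    by (intro finite_measure_subadditive_finite) auto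
  also have "\<dots> = n * measure M A"
    unfolding measure_iter_preimage[OF A(1)] by simp
  also have "\<dots> \<le> \<epsilon> / 2"
    using A(3) n(2) by (simp add: field_simps)
  finally have W: "measure M W \<le> \<epsilon> / 2" .
  have Z: "measure M Z = 0"
    unfolding Z_def by (rule never_hits_measure_zero[OF A(1,2)])
  have "space M - G = Z \<union> U \<union> W"
    unfolding G_def using meas[THEN sets.sets_into_space] by blast
  then have "measure M (space M - G) \<le> measure M Z + measure M U + measure M W"
    using measure_Un_le[of "Z \<union> U" M W] measure_Un_le[of Z M U] meas by auto
  then have G: "measure M (space M - G) \<le> \<epsilon>"
    using Z U W by simp
  have good: "D * v x \<le> \<epsilon> \<and>
      (\<exists>N. D \<le> real N \<and> N \<le> n \<and> v ((T ^^ N) x) = D * n \<and>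
        (\<Sum>i<N. v ((T ^^ i) x)) \<le> D * n / (\<theta> - 1))" if "x \<in> G" for x
  proof -
    have x: "x \<in> space M" "x \<notin> Z" "x \<notin> U" "x \<notin> W"
      using that by (auto simp: G_def)
    obtain j where j: "(T ^^ j) x \<in> A"
      using x(1,2) unfolding Z_def by blast
    have "\<not> hit A x < n"
      using x(1,4) hit_in[OF j] unfolding W_def by blast
    then obtain j' where j': "j' < n" "(T ^^ j') x \<in> B"
      using B(3)[OF x(1) j] by auto
    have late: "(T ^^ i) x \<notin> B" if "i \<le> J" for i
      using x(1,3) that unfolding U_def by (auto simp: less_Suc_eq_le)
    \<comment> \<open>One factor \<open>D\<close> is the scale of \<open>v\<close>, the other the
      demanded smallness; hence \<open>D * D\<close> in the choice of \<open>J\<close> and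
      \<open>n\<close>.\<close>
    have "D * v x \<le> D * (D * n * (1 / \<theta>) ^ J)"
      unfolding v_def using decay_small[OF _ late, of \<theta>] l D
      by (intro mult_left_mono) auto
    then have "D * v x \<le> \<epsilon>"
      using n(4) by (simp add: mult_ac)
    moreover have "D \<le> real (hit B x)"
    proof -
      have "J \<le> hit B x"
        using late hit_in[OF j'(2)] by (metis nat_le_linear)
      then show ?thesis
        using n(1) by linarith
    qed
    moreover have "hit B x \<le> n"
      using hit_le[OF j'(2)] j'(1) by simp
    moreover have "v ((T ^^ hit B x) x) = D * n"
    proof -
      have "(T ^^ 0) ((T ^^ hit B x) x) \<in> B"
        using hit_in[OF j'(2)] by simp
      moreover from this have "hit B ((T ^^ hit B x) x) = 0"
        using hit_le by blast
      ultimately have "decay \<theta> B ((T ^^ hit B x) x) = 1"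
        unfolding decay_def by (metis power_0)
      then show ?thesis
        by (simp add: v_def)
    qed
    moreover have "(\<Sum>i<hit B x. v ((T ^^ i) x)) \<le> D * n / (\<theta> - 1)"
      using mult_left_mono[OF decay_sum[OF l j'(2)], of "D * n"] D
      by (simp add: v_def sum_distrib_left)
    ultimately show ?thesis
      by blast
  qed
  have "v \<in> borel_measurable M"
    unfolding v_def[abs_def] using B(1) by measurable
  moreover have "0 \<le> v x \<and> v x \<le> D * n \<and> v (T x) \<le> \<theta> * v x" for x
    using D l decay_nonneg[of \<theta> B x] mult_left_mono[OF decay_le_1[of \<theta> B x], of "D * n"]
      mult_left_mono[OF decay_step[of \<theta> B x], of "D * n"]
    by (auto simp: v_def mult_ac)
  moreover have "G \<in> sets M"
    unfolding G_def using meas by auto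
  ultimately have "stage M T \<theta> D \<epsilon> v n G"
    unfolding stage_def using G good by blast
  then show ?thesis
    by blast
qed

section \<open>Extravagance of a sum of stages\<close>

text \<open>Read backwards, the values shrink at most by the factor \<theta> per step, so the past
  sum is at least \<open>g (Suc n)\<close> times a finite geometric series.\<close>

lemma geometric_growth_sum_bound:
  fixes g :: "nat \<Rightarrow> real"
  assumes "\<theta> > 1" "\<And>i. 0 \<le> g i" "\<And>i. g (Suc i) \<le> \<theta> * g i"
  shows "g (Suc n) * (1 - (1 / \<theta>) ^ Suc n) \<le> (\<theta> - 1) * (\<Sum>k\<le>n. g k)"
proof (induction n)
  case 0
  have "g (Suc 0) * (1 - 1 / \<theta>) \<le> \<theta> * g 0 * (1 - 1 / \<theta>)"
    using assms by (intro mult_right_mono) auto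
  also have "\<dots> = (\<theta> - 1) * g 0"
    using assms(1) by (simp add: field_simps)
  finally show ?case
    by simp
next
  case (Suc n)
  have "g (Suc (Suc n)) * (1 - (1 / \<theta>) ^ Suc (Suc n))
      \<le> \<theta> * g (Suc n) * (1 - (1 / \<theta>) ^ Suc (Suc n))"
    using assms by (intro mult_right_mono) (auto intro!: power_le_one simp del: power_Suc)
  also have "\<dots> = (\<theta> - 1) * g (Suc n) + g (Suc n) * (1 - (1 / \<theta>) ^ Suc n)"
    using assms(1) by (simp add: field_simps)
  also have "\<dots> \<le> (\<theta> - 1) * (\<Sum>k\<le>Suc n. g k)"
    using Suc by (simp add: algebra_simps)
  finally show ?case .
qed

text \<open>The growth bound gives the upper estimate. The quotient at time \<open>N k\<close> is at
  least \<open>1 / (1 / (\<theta> - 1) + 2 / Suc k)\<close>, and \<open>Suc k \<le> N k\<close>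
  makes these times arbitrarily late.\<close>

lemma extravagance_eq:
  fixes g :: "nat \<Rightarrow> real" and N :: "nat \<Rightarrow> nat" and c :: "nat \<Rightarrow> real"
  assumes \<theta>: "\<theta> > 1" and g: "\<And>i. 0 \<le> g i" "\<And>i. g (Suc i) \<le> \<theta> * g i"
    and N: "\<And>k. k \<ge> k0 \<Longrightarrow> Suc k \<le> N k"
    and c: "\<And>k. k \<ge> k0 \<Longrightarrow> 0 < c k"
    and peak: "\<And>k. k \<ge> k0 \<Longrightarrow> c k \<le> g (N k)"
    and past: "\<And>k. k \<ge> k0 \<Longrightarrow> (\<Sum>i<N k. g i) \<le> c k * (1 / (\<theta> - 1) + 2 / Suc k)"
  shows "extravagance g = ereal (\<theta> - 1)"
proof -
  let ?r = "\<theta> - 1"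
  let ?q = "1 / \<theta>"
  let ?R = "\<lambda>n. g (Suc n) / (\<Sum>k\<le>n. g k)"
  have q: "norm ?q < 1" "0 < ?q" "?q < 1"
    using \<theta> by auto
  have sum_nn: "0 \<le> (\<Sum>k\<le>n. g k)" for n
    using g(1) by (simp add: sum_nonneg)
  have qn: "0 < 1 - ?q ^ Suc n" for n
    using q(2,3) power_Suc_less_one[of ?q n] by simp
  \<comment> \<open>If the denominator vanishes, the quotient is 0 by convention and the bound is
    trivial.\<close>
  have upper: "?R n \<le> ?r / (1 - ?q ^ Suc n)" for n
  proof (cases "(\<Sum>k\<le>n. g k) = 0")
    case True
    then show ?thesis
      using \<theta> qn[of n] by simp
  next
    case False
    then have "0 < (\<Sum>k\<le>n. g k)"
      using sum_nn[of n] by linarith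
    then show ?thesis
      using geometric_growth_sum_bound[of \<theta> g n, OF \<theta> g] qn[of n]
      by (simp add: pos_divide_le_eq pos_le_divide_eq del: power_Suc)
  qed
  have "(\<lambda>n. ?r / (1 - ?q ^ Suc n)) \<longlonglongrightarrow> ?r / (1 - 0)"
    by (intro tendsto_intros LIMSEQ_Suc LIMSEQ_power_zero q(1)) auto
  then have lim: "(\<lambda>n. ereal (?r / (1 - ?q ^ Suc n))) \<longlonglongrightarrow> ereal ?r"
    by simp
  have "limsup (\<lambda>n. ereal (?R n)) \<le> limsup (\<lambda>n. ereal (?r / (1 - ?q ^ Suc n)))"
    using upper by (intro Limsup_mono always_eventually) auto
  also have "\<dots> = ereal ?r"
    by (rule lim_imp_Limsup[OF sequentially_bot lim])
  finally have le: "limsup (\<lambda>n. ereal (?R n)) \<le> ereal ?r" .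
  have "\<not> limsup (\<lambda>n. ereal (?R n)) < ereal ?r"
  proof
    assume "limsup (\<lambda>n. ereal (?R n)) < ereal ?r"
    then obtain y where y: "limsup (\<lambda>n. ereal (?R n)) < ereal y" "ereal y < ereal ?r"
      using ereal_dense2 by blast
    from Limsup_lessD[OF y(1)] obtain n0 where n0: "\<And>n. n \<ge> n0 \<Longrightarrow> ?R n < y"
      by (auto simp: eventually_sequentially)
    have "(\<lambda>k. 1 / (1 / ?r + 2 * (1 / real (Suc k)))) \<longlonglongrightarrow> 1 / (1 / ?r + 2 * 0)"
      using \<theta> by (intro tendsto_intros LIMSEQ_Suc[OF lim_1_over_n]) auto
    then have "\<forall>\<^sub>F k in sequentially. y < 1 / (1 / ?r + 2 * (1 / real (Suc k)))"
      using y(2) by (intro order_tendstoD(1)) auto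
    then obtain k1 where k1: "\<And>k. k \<ge> k1 \<Longrightarrow> y < 1 / (1 / ?r + 2 * (1 / real (Suc k)))"
      by (auto simp: eventually_sequentially)
    define k where "k = max k0 (max k1 n0)"
    have k: "k \<ge> k0" "k \<ge> k1" "k \<ge> n0"
      by (auto simp: k_def)
    define n where "n = N k - 1"
    have n: "N k = Suc n" "n \<ge> n0"
      using N[OF k(1)] k(3) by (auto simp: n_def)
    let ?a = "1 / ?r + 2 / Suc k"
    have a: "0 < ?a"
      using \<theta> by (intro add_pos_pos) auto
    have S: "(\<Sum>i\<le>n. g i) \<le> c k * ?a"
      using past[OF k(1)] n(1) by (simp add: lessThan_Suc_atMost)
    have gN: "c k \<le> g (Suc n)"
      using peak[OF k(1)] n(1) by simp
    have "0 < g (Suc n) * (1 - ?q ^ Suc n)"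
      using gN c[OF k(1)] qn[of n] by (intro mult_pos_pos) auto
    \<comment> \<open>A positive peak cannot follow a zero past, again by the growth bound; so the
      quotient at the peak is a genuine one.\<close>
    then have "0 < ?r * (\<Sum>i\<le>n. g i)"
      using geometric_growth_sum_bound[of \<theta> g n, OF \<theta> g] by linarith
    then have Spos: "0 < (\<Sum>i\<le>n. g i)"
      using \<theta> by (simp add: zero_less_mult_iff)
    have "1 / ?a = c k / (c k * ?a)"
      using c[OF k(1)] by simp
    also have "\<dots> \<le> g (Suc n) / (\<Sum>i\<le>n. g i)"
      using S gN Spos c[OF k(1)] by (intro frac_le) auto
    also have "\<dots> < y"
      using n0[OF n(2)] .
    finally show False
      using k1[OF k(2)] by simp
  qed
  moreover have "\<not> (\<forall>n. g n = 0)"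
    using peak[of k0] c[of k0] by (metis leD order_refl)
  ultimately show ?thesis
    using le unfolding extravagance_def by (auto intro: antisym simp: not_less)
qed

text \<open>Here \<open>w l i\<close> is the \<open>l\<close>-th stage function at time
  \<open>i\<close> along one fixed orbit, which is good for all stages from \<open>k0\<close> on. At
  the peak of stage \<open>k\<close>, the earlier and the later stages each contribute at most
  \<open>c k / Suc k\<close> to the past sum.\<close>

lemma extravagance_stage_sum:
  fixes w :: "nat \<Rightarrow> nat \<Rightarrow> real" and D :: "nat \<Rightarrow> real" and n :: "nat \<Rightarrow> nat"
    and \<theta> :: real
  assumes \<theta>: "\<theta> > 1"
    and w: "\<And>l i. 0 \<le> w l i" "\<And>l i. w l i \<le> D l * n l" "\<And>l i. w l (Suc i) \<le> \<theta> * w l i"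
    and D0: "D 0 = 1"
    and DSuc: "\<And>l. D (Suc l) = (real l + 2) * (D l + D l * n l) + n l * \<theta> ^ n l"
    and good: "\<And>l. l \<ge> k0 \<Longrightarrow> D l * w l 0 \<le> (1 / 2) ^ l \<and>
      (\<exists>N. D l \<le> real N \<and> N \<le> n l \<and> w l N = D l * n l \<and> (\<Sum>i<N. w l i) \<le> D l * n l / (\<theta> - 1))"
  shows "extravagance (\<lambda>i. max 0 (\<Sum>l. w l i)) = ereal (\<theta> - 1)"
proof -
  define c where "c l = D l * n l" for l
  \<comment> \<open>The first term of the recursion lets \<open>D k\<close> outweigh all earlier
    peaks, even by the factor \<open>k + 1\<close>.\<close>
  have D_ge: "(real k + 1) * (1 + (\<Sum>l<k. c l)) \<le> D k" for k
  proof (induction k)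
    case (Suc k)
    have nn: "0 \<le> (\<Sum>l<k. c l)"
      unfolding c_def using w(1,2) by (intro sum_nonneg) (meson order_trans)
    have "1 * (1 + (\<Sum>l<k. c l)) \<le> (real k + 1) * (1 + (\<Sum>l<k. c l))"
      using nn by (intro mult_right_mono) auto
    then have "1 + (\<Sum>l<k. c l) \<le> D k"
      using Suc by simp
    then have "(real k + 2) * (1 + (\<Sum>l<k. c l) + c k) \<le> (real k + 2) * (D k + c k)"
      by (intro mult_left_mono) auto
    also have "\<dots> \<le> D (Suc k)"
      unfolding DSuc c_def using \<theta> by simp
    finally show ?case
      by (simp add: algebra_simps)
  qed (simp add: D0)
  have c_nn: "0 \<le> c l" for l
    unfolding c_def using w(1,2) by (meson order_trans)
  have csum_nn: "0 \<le> (\<Sum>l<k. c l)" for k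
    using c_nn by (simp add: sum_nonneg)
  have D_k: "real k + 1 \<le> D k" for k
  proof -
    have "(real k + 1) * 1 \<le> (real k + 1) * (1 + (\<Sum>l<k. c l))"
      using csum_nn by (intro mult_left_mono) auto
    then show ?thesis
      using D_ge[of k] by (metis mult_1_right order_trans)
  qed
  have D_1: "1 \<le> D k" for k
    using D_k[of k] by simp
  have "D l \<le> D (Suc l)" for l
  proof -
    have "D l \<le> 1 * (D l + D l * n l)"
      using D_1[of l] by simp
    also have "\<dots> \<le> (real l + 2) * (D l + D l * n l)"
      using D_1[of l] by (intro mult_right_mono add_nonneg_nonneg) auto
    also have "\<dots> \<le> D (Suc l)"
      unfolding DSuc using \<theta> by simp
    finally show ?thesis .
  qed
  then have D_mono: "D l \<le> D m" if "l \<le> m" for l m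
    using that by (rule lift_Suc_mono_le)
  \<comment> \<open>The second term of the recursion makes later stages start so small that
    \<open>n k\<close> steps of growth, summed over \<open>n k\<close> times, remain
    harmless.\<close>
  have D_big: "n k * \<theta> ^ n k \<le> D l" if "k < l" for k l
  proof -
    have "n k * \<theta> ^ n k \<le> D (Suc k)"
      unfolding DSuc using D_1[of k] by simp
    also have "\<dots> \<le> D l"
      using that by (intro D_mono) simp
    finally show ?thesis .
  qed
  have w_pow: "w l i \<le> \<theta> ^ i * w l 0" for l i
  proof (induction i)
    case (Suc i)
    have "w l (Suc i) \<le> \<theta> * w l i"
      by (rule w)
    also have "\<dots> \<le> \<theta> * (\<theta> ^ i * w l 0)"
      using Suc \<theta> by (intro mult_left_mono) auto
    finally show ?case
      by (simp add: mult_ac)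
  qed simp
  have w0: "w l 0 \<le> (1 / 2) ^ l" if "l \<ge> k0" for l
  proof -
    have "1 * w l 0 \<le> D l * w l 0"
      using D_1[of l] w(1) by (intro mult_right_mono) auto
    then show ?thesis
      using good[OF that] by simp
  qed
  have summ: "summable (\<lambda>l. w l i)" for i
  proof (rule summable_comparison_test)
    show "\<exists>L. \<forall>l\<ge>L. norm (w l i) \<le> \<theta> ^ i * (1 / 2) ^ l"
    proof (intro exI allI impI)
      fix l assume "k0 \<le> l"
      then have "\<theta> ^ i * w l 0 \<le> \<theta> ^ i * (1 / 2) ^ l"
        using w0 \<theta> by (intro mult_left_mono) auto
      then show "norm (w l i) \<le> \<theta> ^ i * (1 / 2) ^ l"
        using w_pow[of l i] w(1)[of l i] by simp
    qed
    show "summable (\<lambda>l. \<theta> ^ i * (1 / 2) ^ l)"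
      by (intro summable_mult summable_geometric) simp
  qed
  define g where "g i = (\<Sum>l. w l i)" for i
  have g_nn: "0 \<le> g i" for i
    unfolding g_def using w(1) summ by (intro suminf_nonneg) auto
  have g_step: "g (Suc i) \<le> \<theta> * g i" for i
    unfolding g_def using summ w(3)
    by (subst suminf_mult[symmetric]) (auto intro!: suminf_le summable_mult)
  obtain N where N: "\<And>l. l \<ge> k0 \<Longrightarrow> D l \<le> real (N l)" "\<And>l. l \<ge> k0 \<Longrightarrow> N l \<le> n l"
    "\<And>l. l \<ge> k0 \<Longrightarrow> w l (N l) = c l" "\<And>l. l \<ge> k0 \<Longrightarrow> (\<Sum>i<N l. w l i) \<le> c l / (\<theta> - 1)"
    using good unfolding c_def by metis
  have n1: "1 \<le> real (n k)" if "k \<ge> k0" for k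
    using N(1,2)[OF that] D_1[of k] by linarith
  have cD: "D k \<le> c k" if "k \<ge> k0" for k
    using mult_left_mono[OF n1[OF that], of "D k"] D_1[of k] by (simp add: c_def)
  have "extravagance g = ereal (\<theta> - 1)"
  proof (rule extravagance_eq[where ?k0.0 = k0 and N = N and c = c])
    fix k assume k: "k \<ge> k0"
    show "Suc k \<le> N k"
      using N(1)[OF k] D_k[of k] by linarith
    show "0 < c k"
      using cD[OF k] D_1[of k] by linarith
    show "c k \<le> g (N k)"
      using sum_le_suminf[OF summ[of "N k"], of "{k}"] w(1) N(3)[OF k] by (simp add: g_def)
    have split: "g i = (\<Sum>l<k. w l i) + w k i + (\<Sum>l. w (l + Suc k) i)" for i
      unfolding g_def using suminf_split_initial_segment[OF summ[of i], of "Suc k"] by simp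
    have "(\<Sum>i<N k. \<Sum>l<k. w l i) \<le> (\<Sum>i<N k. \<Sum>l<k. c l)"
      unfolding c_def using w(2) by (intro sum_mono)
    also have "\<dots> = N k * (\<Sum>l<k. c l)"
      by simp
    also have "\<dots> \<le> n k * (D k / Suc k)"
    proof (intro mult_mono)
      have "(real k + 1) * (\<Sum>l<k. c l) \<le> D k"
        using D_ge[of k] by (simp add: algebra_simps)
      then show "(\<Sum>l<k. c l) \<le> D k / Suc k"
        by (simp add: field_simps)
    qed (use N(2)[OF k] csum_nn in auto)
    also have "\<dots> = c k / Suc k"
      by (simp add: c_def)
    finally have early: "(\<Sum>i<N k. \<Sum>l<k. w l i) \<le> c k / Suc k" .
    \<comment> \<open>At most \<open>n k\<close> times precede the peak, so all later stages
      together contribute at most 1 to the past.\<close>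
    have tail: "(\<Sum>l. w (l + Suc k) i) \<le> 1 / n k" if "i < N k" for i
    proof -
      have "n k * w (l + Suc k) i \<le> (1 / 2) ^ Suc l" for l
      proof -
        let ?l = "l + Suc k"
        have "n k * w ?l i \<le> n k * (\<theta> ^ n k * w ?l 0)"
        proof (intro mult_left_mono)
          have "\<theta> ^ i * w ?l 0 \<le> \<theta> ^ n k * w ?l 0"
            using \<theta> that N(2)[OF k] w(1) by (intro mult_right_mono power_increasing) auto
          then show "w ?l i \<le> \<theta> ^ n k * w ?l 0"
            using w_pow order_trans by blast
        qed simp
        also have "\<dots> = (n k * \<theta> ^ n k) * w ?l 0"
          by simp
        also have "\<dots> \<le> D ?l * w ?l 0"
          using w(1) by (intro mult_right_mono D_big) auto
        also have "\<dots> \<le> (1 / 2) ^ ?l"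
          using good[of ?l] k by auto
        also have "\<dots> \<le> (1 / 2) ^ Suc l"
          by (intro power_decreasing) auto
        finally show ?thesis .
      qed
      then have le: "w (l + Suc k) i \<le> 1 / n k * (1 / 2) ^ Suc l" for l
        using n1[OF k] by (simp add: field_simps del: add_Suc_right)
      have "(\<Sum>l. w (l + Suc k) i) \<le> (\<Sum>l. 1 / n k * (1 / 2) ^ Suc l)"
        by (intro suminf_le le summable_mult summable_ignore_initial_segment[OF summ]
            sums_summable[OF power_half_series])
      also have "\<dots> = 1 / n k"
        by (subst sums_unique[OF sums_mult[OF power_half_series], symmetric]) simp
      finally show ?thesis .
    qed
    have "(\<Sum>i<N k. \<Sum>l. w (l + Suc k) i) \<le> (\<Sum>i<N k. 1 / n k)"
      using tail by (intro sum_mono) simp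
    also have "\<dots> \<le> 1"
      using N(2)[OF k] n1[OF k] by simp
    also have "1 \<le> c k / Suc k"
      using cD[OF k] D_k[of k] by (simp add: field_simps)
    finally have late: "(\<Sum>i<N k. \<Sum>l. w (l + Suc k) i) \<le> c k / Suc k" .
    have "(\<Sum>i<N k. g i) \<le> c k / Suc k + c k / (\<theta> - 1) + c k / Suc k"
      unfolding split sum.distrib using early late N(4)[OF k] by (intro add_mono)
    also have "\<dots> = c k * (1 / (\<theta> - 1) + 2 / Suc k)"
      by (simp add: distrib_left)
    finally show "(\<Sum>i<N k. g i) \<le> c k * (1 / (\<theta> - 1) + 2 / Suc k)" .
  qed (use \<theta> g_nn g_step in auto)
  moreover have "(\<lambda>i. max 0 (\<Sum>l. w l i)) = g"
    using g_nn by (auto simp: g_def max_def fun_eq_iff antisym)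
  ultimately show ?thesis
    by simp
qed

section \<open>Choosing the stages and summing them\<close>

theorem mainTheorem3:
  fixes M :: "'a measure" and T :: "'a \<Rightarrow> 'a" and r :: real
  assumes "standard_probability_space M"
    and "measure_preserving_map M T"
    and "ergodic_map M T"
    and "aperiodic_map M T"
    and "0 \<le> r"
  shows "\<exists>g :: 'a \<Rightarrow> real. g \<in> borel_measurable M \<and> (\<forall>x\<in>space M. 0 \<le> g x) \<and>
           (AE x in M. extravagance_fun g T x = ereal r)"
proof (cases "r = 0")
  case True
  then show ?thesis
    by (intro exI[of _ "\<lambda>_. 0"]) (simp add: extravagance_fun_def extravagance_def)
next
  case False
  interpret prob_space M
    using assms(1) by (simp add: standard_probability_space_def)
  interpret ergodic_system M T
    using assms(2,3) by unfold_locales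
  define \<theta> where "\<theta> = 1 + r"
  have \<theta>: "\<theta> > 1"
    using False assms(5) by (simp add: \<theta>_def)
  \<comment> \<open>With \<open>D \<ge> 1\<close> inside the existential, the choice yields
    functions defined for all \<open>D\<close> and \<open>l\<close>, before the sequence
    \<open>D\<close> is known.\<close>
  have "\<exists>v n G. D \<ge> 1 \<longrightarrow> stage M T \<theta> D ((1 / 2) ^ l) v n G" for D :: real and l :: nat
    using stage_exists[OF standard_small_set[OF assms(1) point_measure_zero[OF assms(1,4)]] \<theta>,
        of D "(1 / 2) ^ l"] by fastforce
  then obtain v0 :: "real \<Rightarrow> nat \<Rightarrow> 'a \<Rightarrow> real" and n0 G0
    where stage0: "\<And>D l. D \<ge> 1 \<Longrightarrow> stage M T \<theta> D ((1 / 2) ^ l) (v0 D l) (n0 D l) (G0 D l)"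
    by metis
  \<comment> \<open>The height of stage \<open>l\<close> is determined by \<open>D l\<close>, so the
    recursion need only carry the number \<open>D\<close>.\<close>
  define D where "D = rec_nat 1 (\<lambda>l d. (real l + 2) * (d + d * n0 d l) + n0 d l * \<theta> ^ n0 d l)"
  define v n G where "v l = v0 (D l) l" and "n l = n0 (D l) l" and "G l = G0 (D l) l" for l
  have D0: "D 0 = 1"
    and DSuc: "D (Suc l) = (real l + 2) * (D l + D l * n l) + n l * \<theta> ^ n l" for l
    by (simp_all add: D_def n_def)
  have "D l \<ge> 1" for l
  proof (induction l)
    case (Suc l)
    have "1 * 1 \<le> (real l + 2) * (D l + D l * n l)"
      using Suc by (intro mult_mono) (auto intro: add_increasing2)
    then show ?case
      unfolding DSuc using \<theta> by (simp add: add_increasing2)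
  qed (simp add: D0)
  then have stage: "stage M T \<theta> (D l) ((1 / 2) ^ l) (v l) (n l) (G l)" for l
    unfolding v_def n_def G_def by (rule stage0)
  \<comment> \<open>The maximum ensures \<open>0 \<le> g x\<close> even where the series diverges
    and its value is unspecified; on good orbits it changes nothing.\<close>
  define g where "g x = max 0 (\<Sum>l. v l x)" for x
  have v_meas[measurable]: "v l \<in> borel_measurable M" for l
    using stage[of l] by (simp add: stage_def)
  have G_meas: "G l \<in> sets M" for l
    using stage[of l] by (simp add: stage_def)
  \<comment> \<open>Borel-Cantelli: the exceptional sets have summable measures, so almost every
    point is good for all but finitely many stages.\<close>
  have "AE x in M. eventually (\<lambda>l. x \<in> space M - (space M - G l)) sequentially"
  proof (rule borel_cantelli_AE1)
    show "summable (\<lambda>l. measure M (space M - G l))"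
    proof (rule summable_comparison_test)
      show "\<exists>L. \<forall>l\<ge>L. norm (measure M (space M - G l)) \<le> (1 / 2) ^ l"
        using stage by (auto simp: stage_def)
      show "summable (\<lambda>l. (1 / 2 :: real) ^ l)"
        by (intro summable_geometric) simp
    qed
  qed (use G_meas in \<open>auto simp: emeasure_eq_measure\<close>)
  then have "AE x in M. extravagance_fun g T x = ereal r"
  proof (rule AE_mp, intro AE_I2 impI)
    fix x assume "eventually (\<lambda>l. x \<in> space M - (space M - G l)) sequentially"
    then obtain k0 where k0: "\<And>l. l \<ge> k0 \<Longrightarrow> x \<in> G l"
      by (auto simp: eventually_sequentially)
    have "extravagance (\<lambda>i. max 0 (\<Sum>l. v l ((T ^^ i) x))) = ereal (\<theta> - 1)"
    proof (rule extravagance_stage_sum[OF \<theta> _ _ _ D0 DSuc, of _ k0])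
      show "D l * v l ((T ^^ 0) x) \<le> (1 / 2) ^ l \<and>
        (\<exists>N. D l \<le> real N \<and> N \<le> n l \<and> v l ((T ^^ N) x) = D l * n l \<and>
          (\<Sum>i<N. v l ((T ^^ i) x)) \<le> D l * n l / (\<theta> - 1))" if "l \<ge> k0" for l
        using stage[of l] k0[OF that] by (auto simp: stage_def)
    qed (use stage in \<open>auto simp: stage_def\<close>)
    then show "extravagance_fun g T x = ereal r"
      by (simp add: extravagance_fun_def g_def \<theta>_def)
  qed
  moreover have "g \<in> borel_measurable M"
    unfolding g_def[abs_def] by measurable
  moreover have "\<forall>x\<in>space M. 0 \<le> g x"
    by (simp add: g_def)
  ultimately show ?thesis
    by blast
qed

end
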